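(* Consider $N$ agents whose states stack into $x\in\mathbb{R}^n$, each state coordinate belonging to exactly one agent. Let $A\in\mathbb{R}^{n\times n}$, $W\in\mathbb{R}^{n\times n}$ symmetric positive definite, $C=\mathrm{diag}(C_{11},\dots,C_{nn})$ diagonal positive definite (block-diagonal over agents, agent $i$'s block being $C_i$). For each agent $i$ let $\Delta_{\ell_2}y_i>0$ be the $\ell_2$-sensitivity of its output map, take $\delta_i\in[10^{-5},10^{-1}]$, $\epsilon_i>0$, and set $\sigma_i=\frac{\Delta_{\ell_2}y_i}{2\epsilon_i}\big(K_{\delta_i}+\sqrt{K_{\delta_i}^2+2\epsilon_i}\big)$; let $V$ be the diagonal matrix whose $j$-th diagonal entry is $\sigma_i^2$ for the agent $i$ owning coordinate $j$. Let $\Sigma$ be the unique positive semidefinite solution of $\Sigma=A\Sigma A^T-A\Sigma C^T(C\Sigma C^T+V)^{-1}C\Sigma A^T+W$ (the MSE matrix of the a priori predictions). Let $B_l,B_u$ be real numbers and define, for each $i$, $$\eta_1:=\left(\frac{(B_l-\mathrm{tr}W)\lambda_n(W)C_u^2}{(\Delta_{\ell_2}y_i)^2\big(\mathrm{tr}(A^TA)\lambda_n(W)-B_l+\mathrm{tr}W\big)}\right)^{1/2},\quad \eta_2:=\left(\frac{(B_u-\mathrm{tr}W)C_l^2}{(\Delta_{\ell_2}y_i)^2\,\mathrm{tr}(A^TA)}\right)^{1/2},$$ assumed to be positive real numbers. If every agent $i$ chooses $\epsilon_i$ with $$\frac18\left(\frac{1+\sqrt{36\eta_2+1}}{\eta_2}\right)^2\le\epsilon_i\le\frac1{\eta_1},$$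 then $B_l\le\mathrm{tr}\,\Sigma\le B_u$.
   Context: $\mathcal{Q}(y)=\frac{1}{\sqrt{2\pi}}\int_y^\infty e^{-z^2/2}dz$ and $K_\delta=\mathcal{Q}^{-1}(\delta)$. $\lambda_n(\cdot)$ is the smallest eigenvalue. With $\sigma_j$ denoting the noise level of coordinate $j$ (i.e. $V_{jj}=\sigma_j^2$), $l=\arg\min_j C_{jj}^2/\sigma_j^2$, $u=\arg\max_j C_{jj}^2/\sigma_j^2$, $C_l=C_{ll}$, $C_u=C_{uu}$. The $\ell_2$-sensitivity of agent $i$'s output $y_i(k)=C_ix_i(k)$ is $\sup\|C_ix_i-C_ix_i'\|_{\ell_2}$ over state trajectories with $\|x_i-x_i'\|_{\ell_2}\le b_i$ for a given adjacency parameter $b_i>0$. *)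

theory Defs
  imports "HOL-Analysis.Analysis"
begin

definition Qfun :: "real \<Rightarrow> real" where
  "Qfun y = integral {y..} (\<lambda>z. exp (- (z\<^sup>2) / 2)) / sqrt (2 * pi)"

definition Kdelta :: "real \<Rightarrow> real" where
  "Kdelta \<delta> = (THE y. Qfun y = \<delta>)"

definition psd_matrix :: "real^'n^'n \<Rightarrow> bool" where
  "psd_matrix M \<longleftrightarrow> transpose M = M \<and> (\<forall>x. 0 \<le> x \<bullet> (M *v x))"

definition pd_matrix :: "real^'n^'n \<Rightarrow> bool" where
  "pd_matrix M \<longleftrightarrow> transpose M = M \<and> (\<forall>x. x \<noteq> 0 \<longrightarrow> 0 < x \<bullet> (M *v x))"

definition diagonal_matrix :: "real^'n^'n \<Rightarrow> bool" where
  "diagonal_matrix M \<longleftrightarrow> (\<forall>i j. i \<noteq> j \<longrightarrow> M $ i $ j = 0)"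

definition min_eigenvalue :: "real^'n^'n \<Rightarrow> real" where
  "min_eigenvalue M = Min {c. \<exists>v. v \<noteq> 0 \<and> M *v v = c *\<^sub>R v}"

text \<open>Trajectories of an agent whose coordinates form the set S: sequences
  d :: nat \<Rightarrow> 'n \<Rightarrow> real (only the coordinates in S matter).\<close>
definition traj_in_l2 :: "'n set \<Rightarrow> (nat \<Rightarrow> 'n \<Rightarrow> real) \<Rightarrow> bool" where
  "traj_in_l2 S d \<longleftrightarrow> summable (\<lambda>k. \<Sum>j\<in>S. (d k j)\<^sup>2)"

definition traj_l2_norm :: "'n set \<Rightarrow> (nat \<Rightarrow> 'n \<Rightarrow> real) \<Rightarrow> real" where
  "traj_l2_norm S d = sqrt (\<Sum>k. \<Sum>j\<in>S. (d k j)\<^sup>2)"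

text \<open>l2-sensitivity of the output y_i(k) = C_i x_i(k) of the agent owning coordinates S,
  with adjacency parameter b: sup of ||C_i x_i - C_i x_i'||_l2 over state trajectories
  with ||x_i - x_i'||_l2 \<le> b.  Here C is diagonal, so (C_i x_i)_j = C_jj x_j.\<close>
definition output_sensitivity :: "real^'n^'n \<Rightarrow> 'n set \<Rightarrow> real \<Rightarrow> real" where
  "output_sensitivity C S b =
     Sup {traj_l2_norm S (\<lambda>k j. C $ j $ j * x k j - C $ j $ j * x' k j) | x x'.
            traj_in_l2 S (\<lambda>k j. x k j - x' k j) \<and>
            traj_l2_norm S (\<lambda>k j. x k j - x' k j) \<le> b}"

end

theory Submission
  imports Defs
begin

text \<open>
  Write the Riccati equation as \<open>\<Sigma> = A P A\<^sup>T + W\<close>, where \<open>P\<close> is the a posteriori covariance. Its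
  quadratic form is the minimum over \<open>w\<close> of \<open>(x - C\<^sup>T w) \<bullet> \<Sigma> (x - C\<^sup>T w) + w \<bullet> V w\<close>, so no
  inverse has to be estimated: taking \<open>w = C\<^sup>-\<^sup>1 x\<close> gives \<open>P \<le> (\<sigma>\<^sub>l\<^sup>2 / C\<^sub>l\<^sup>2) I\<close>, while
  \<open>\<Sigma> \<ge> W \<ge> \<lambda>\<^sub>n(W) I\<close> bounds the cost of every \<open>w\<close> and yields
  \<open>P \<ge> (1 / \<lambda>\<^sub>n(W) + C\<^sub>u\<^sup>2 / \<sigma>\<^sub>u\<^sup>2)\<^sup>-\<^sup>1 I\<close>. Taking traces reduces the claim to
  \<open>\<eta>\<^sub>1 \<Delta> \<le> \<sigma> \<le> \<eta>\<^sub>2 \<Delta>\<close>, which the bounds on \<open>\<epsilon>\<close> ensure because \<open>1 \<le> K\<^sub>\<delta> \<le> 9/2\<close> for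
  \<open>\<delta>\<close> between \<open>10\<^sup>-\<^sup>5\<close> and \<open>10\<^sup>-\<^sup>1\<close>.
\<close>

section \<open>The Gaussian tail\<close>

text \<open>The exponent is concave in \<open>z\<close>, so it lies below its tangent at
  \<open>y\<close>. The resulting exponential majorant has an elementary integral over a half
  line.\<close>

lemma gaussian_le_exp_tangent:
  fixes y z :: real
  shows "exp (- (z\<^sup>2) / 2) \<le> exp (y\<^sup>2 / 2) * exp (- y * z)"
proof -
  have "0 \<le> (z - y)\<^sup>2" by simp
  then have "- (z\<^sup>2) / 2 \<le> y\<^sup>2 / 2 + - y * z"
    by (simp add: power2_eq_square field_simps)
  then show ?thesis by (simp flip: exp_add)
qed

lemma gaussian_integrable_atLeast:
  fixes y :: real
  shows "(\<lambda>z. exp (- (z\<^sup>2) / 2)) integrable_on {y..}"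
proof (rule measurable_bounded_by_integrable_imp_integrable)
  show "(\<lambda>z. exp (- (z\<^sup>2) / 2)) \<in> borel_measurable (lebesgue_on {y..})"
    by (intro continuous_imp_measurable_on_sets_lebesgue continuous_intros) auto
  \<comment> \<open>The tangent at 1 dominates on the whole line, so one majorant serves every
    \<open>y\<close>.\<close>
  show "(\<lambda>z::real. exp (1\<^sup>2 / 2) * exp (- 1 * z)) integrable_on {y..}"
    using integrable_on_exp_minus_to_infinity[of 1 y]
    by (intro integrable_on_mult_right) simp
  show "norm (exp (- (z\<^sup>2) / 2)) \<le> exp (1\<^sup>2 / 2) * exp (- 1 * z)" for z :: real
    using gaussian_le_exp_tangent[of z 1] by simp
qed auto

lemma Qfun_diff:
  fixes y y' :: real
  assumes "y \<le> y'"
  shows "Qfun y - Qfun y' = integral {y..y'} (\<lambda>z. exp (- (z\<^sup>2) / 2)) / sqrt (2 * pi)"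
proof -
  let ?g = "\<lambda>z::real. exp (- (z\<^sup>2) / 2)"
  have "integral ({y..y'} \<union> {y'..}) ?g = integral {y..y'} ?g + integral {y'..} ?g"
  proof (rule integral_Un)
    show "?g integrable_on {y..y'}"
      by (intro integrable_continuous_real continuous_intros) auto
    have "{y..y'} \<inter> {y'..} \<subseteq> {y'}" by auto
    then show "negligible ({y..y'} \<inter> {y'..})"
      using negligible_sing negligible_subset by blast
  qed (rule gaussian_integrable_atLeast)
  moreover have "{y..y'} \<union> {y'..} = {y..}" using assms by auto
  ultimately show ?thesis
    by (simp add: Qfun_def flip: diff_divide_distrib)
qed

text \<open>On a compact interval the density has a positive lower bound, namely its value at the
  largest modulus. Strictness makes the preimage chosen by \<open>THE\<close> in
  \<open>Kdelta\<close> unique.\<close>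

lemma Qfun_strict_antimono:
  assumes "y < y'"
  shows "Qfun y' < Qfun y"
proof -
  let ?g = "\<lambda>z::real. exp (- (z\<^sup>2) / 2)"
  let ?m = "exp (- (max \<bar>y\<bar> \<bar>y'\<bar>)\<^sup>2 / 2)"
  have "integral {y..y'} (\<lambda>z. ?m) \<le> integral {y..y'} ?g"
  proof (rule integral_le)
    show "?g integrable_on {y..y'}"
      by (intro integrable_continuous_real continuous_intros) auto
    show "?m \<le> ?g z" if "z \<in> {y..y'}" for z
    proof -
      have "\<bar>z\<bar> \<le> max \<bar>y\<bar> \<bar>y'\<bar>" using that by auto
      then have "\<bar>z\<bar>\<^sup>2 \<le> (max \<bar>y\<bar> \<bar>y'\<bar>)\<^sup>2" by (intro power_mono) auto
      then show ?thesis by simp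
    qed
  qed (auto intro: integrable_const_ivl)
  moreover have "0 < integral {y..y'} (\<lambda>z. ?m)" using assms by simp
  ultimately have "0 < integral {y..y'} ?g" by linarith
  then have "0 < integral {y..y'} ?g / sqrt (2 * pi)"
    by (intro divide_pos_pos) auto
  then show ?thesis using Qfun_diff[of y y'] assms by simp
qed

lemma continuous_on_Qfun: "continuous_on {a..b} Qfun"
proof (rule continuous_on_eq)
  show "continuous_on {a..b}
      (\<lambda>y. Qfun a - integral {a..y} (\<lambda>z. exp (- (z\<^sup>2) / 2)) / sqrt (2 * pi))"
    by (intro continuous_intros indefinite_integral_continuous_1 integrable_continuous_real) auto
  show "Qfun a - integral {a..y} (\<lambda>z. exp (- (z\<^sup>2) / 2)) / sqrt (2 * pi) = Qfun y"
    if "y \<in> {a..b}" for y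
    using Qfun_diff[of a y] that by simp
qed

lemma Qfun_nonneg: "0 \<le> Qfun y"
  unfolding Qfun_def by (intro divide_nonneg_nonneg integral_nonneg gaussian_integrable_atLeast) auto

text \<open>Integrating the tangent majorant at \<open>y\<close> over the tail gives the classical
  Mills ratio bound.\<close>

lemma Qfun_le_mills:
  assumes "y > 0"
  shows "Qfun y \<le> exp (- (y\<^sup>2) / 2) / (y * sqrt (2 * pi))"
proof -
  have hi: "((\<lambda>z. exp (y\<^sup>2 / 2) * exp (- y * z)) has_integral exp (y\<^sup>2 / 2) * (exp (- y * y) / y)) {y..}"
    by (intro has_integral_mult_right has_integral_exp_minus_to_infinity assms)
  have "integral {y..} (\<lambda>z. exp (- (z\<^sup>2) / 2)) \<le> exp (y\<^sup>2 / 2) * (exp (- y * y) / y)"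
    using integrable_integral[OF gaussian_integrable_atLeast] hi
    by (rule has_integral_le) (rule gaussian_le_exp_tangent)
  also have "\<dots> = exp (- (y\<^sup>2) / 2) / y"
    by (simp add: power2_eq_square flip: exp_add)
  finally show ?thesis
    by (simp add: Qfun_def divide_right_mono flip: divide_divide_eq_left)
qed

lemma exp_1_ge: "27 / 10 \<le> exp (1 :: real)"
  using e_approx_32 by (simp add: abs_if split: if_split_asm)

text \<open>This makes 9/2 an upper bound for \<open>Kdelta\<close>; twice that value, 9, is the
  source of the constant 36 = 4 * 9 in the lower bound on \<open>\<epsilon>\<close>.\<close>

lemma Qfun_upper: "Qfun (9 / 2) < 10 powr (-5)"
proof -
  have pi: "2 \<le> sqrt (2 * pi)"
    using pi_ge_two by (intro real_le_rsqrt) simp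
  \<comment> \<open>The exponent is 81/8, slightly above 10, so a tenth power of a rational lower
    bound for e suffices.\<close>
  have "(27 / 10 :: real) ^ 10 \<le> exp 1 ^ 10"
    by (intro power_mono exp_1_ge) auto
  also have "\<dots> = exp (10 :: real)"
    by (simp flip: exp_of_nat_mult)
  also have "\<dots> \<le> exp ((9 / 2)\<^sup>2 / 2)"
    by (simp add: power2_eq_square)
  finally have e: "20000 \<le> exp ((9 / 2 :: real)\<^sup>2 / 2)" by (simp add: power_divide)
  have "Qfun (9 / 2) \<le> exp (- ((9 / 2)\<^sup>2) / 2) / (9 / 2 * sqrt (2 * pi))"
    by (rule Qfun_le_mills) simp
  also have "\<dots> \<le> exp (- ((9 / 2)\<^sup>2) / 2) / 9"
    using pi by (intro divide_left_mono) auto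
  also have "\<dots> = 1 / (9 * exp ((9 / 2)\<^sup>2 / 2))"
    by (simp add: exp_minus field_simps)
  also have "\<dots> \<le> 1 / (9 * 20000)"
    using e by (intro divide_left_mono mult_left_mono) auto
  also have "\<dots> < 10 powr (-5)" by (simp add: powr_minus powr_numeral)
  finally show ?thesis .
qed

text \<open>The mass between 1 and 2 alone exceeds 1/10. There the concave exponent lies above its
  chord \<open>1 - 3 / 2 * z\<close>, whose exponential integrates to
  \<open>2 / 3 * (r - exp (- 2))\<close>.\<close>

lemma Qfun_lower: "10 powr (-1) < Qfun 1"
proof -
  let ?g = "\<lambda>z::real. exp (- (z\<^sup>2) / 2)"
  \<comment> \<open>Both exponentials needed are powers of \<open>r\<close>, and its square is 1/e,
    so rational bounds on e control everything.\<close>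
  define r :: real where "r = exp (- 1 / 2)"
  have "r\<^sup>2 = 1 / exp 1"
    by (simp add: r_def exp_minus field_simps flip: exp_double exp_add)
  then have r2: "100 / 272 < r\<^sup>2" "r\<^sup>2 \<le> 10 / 27"
    using e_less_272 exp_1_ge
      divide_strict_left_mono[of "exp 1" "272 / 100" "1 :: real"]
      divide_left_mono[of "27 / 10" "exp 1" "1 :: real"]
    by simp_all
  have r_ge: "r > 606 / 1000"
  proof (rule power_less_imp_less_base[where n = 2])
    show "(606 / 1000)\<^sup>2 < r\<^sup>2" using r2(1) by (simp add: power_divide)
  qed (simp add: r_def)
  have "(r\<^sup>2)\<^sup>2 \<le> (10 / 27)\<^sup>2" using r2(2) by (intro power_mono) auto
  moreover have "exp (- 2) = (r\<^sup>2)\<^sup>2"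
    by (simp add: r_def flip: exp_of_nat_mult)
  ultimately have e2: "exp (- 2 :: real) \<le> 100 / 729" by (simp add: power_divide)
  have int: "((\<lambda>z. exp (1 - 3 / 2 * z)) has_integral
      (- (2 / 3) * exp (1 - 3 / 2 * 2) - - (2 / 3) * exp (1 - 3 / 2 * 1))) {1..2::real}"
    by (intro fundamental_theorem_of_calculus)
       (auto intro!: derivative_eq_intros simp flip: has_real_derivative_iff_has_vector_derivative)
  text \<open>On the interval from 1 to 2 the chord \<open>3 z - 2\<close> lies above \<open>z\<^sup>2\<close>.\<close>
  have "2 / 3 * (r - exp (- 2)) \<le> integral {1..2} ?g"
  proof -
    have g: "(?g has_integral integral {1..2} ?g) {1..2}"
      by (intro integrable_integral integrable_continuous_real continuous_intros) auto
    have "exp (1 - 3 / 2 * z) \<le> ?g z" if "z \<in> {1..2}" for z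
    proof -
      have "0 \<le> (z - 1) * (2 - z)" using that by simp
      then show ?thesis by (simp add: algebra_simps power2_eq_square)
    qed
    from has_integral_le[OF int g this] show ?thesis
      by (simp add: r_def algebra_simps)
  qed
  then have "3 / 10 < integral {1..2} ?g" using r_ge e2 by simp
  moreover have "sqrt (2 * pi) \<le> 29 / 10"
    using pi_less_4 by (intro real_le_lsqrt) (auto simp: power_divide)
  ultimately have "1 / 10 * sqrt (2 * pi) < integral {1..2} ?g" by linarith
  then have "1 / 10 < integral {1..2} ?g / sqrt (2 * pi)"
    by (simp add: pos_less_divide_eq)
  also have "\<dots> = Qfun 1 - Qfun 2" by (simp add: Qfun_diff)
  also have "\<dots> \<le> Qfun 1" using Qfun_nonneg[of 2] by simp
  finally show ?thesis by (simp add: powr_minus)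
qed

text \<open>The intermediate value theorem places a preimage of \<open>\<delta>\<close> between 1
  and 9/2, and strict monotonicity identifies it with \<open>Kdelta \<delta>\<close>. The exact
  range is about 1.28 to 4.27, so there is room for crude numerics.\<close>

lemma Kdelta_bounds:
  assumes "10 powr (-5) \<le> \<delta>" "\<delta> \<le> 10 powr (-1)"
  shows "1 \<le> Kdelta \<delta>" "Kdelta \<delta> \<le> 9 / 2"
proof -
  have "\<exists>y. 1 \<le> y \<and> y \<le> 9 / 2 \<and> Qfun y = \<delta>"
    using Qfun_upper Qfun_lower assms continuous_on_Qfun by (intro IVT2') auto
  then obtain y where y: "1 \<le> y" "y \<le> 9 / 2" "Qfun y = \<delta>" by blast
  have "Kdelta \<delta> = y"
    unfolding Kdelta_def
  proof (rule the_equality)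
    show "z = y" if "Qfun z = \<delta>" for z
      using that y(3) Qfun_strict_antimono[of y z] Qfun_strict_antimono[of z y]
      by (cases y z rule: linorder_cases) auto
  qed (rule y)
  with y show "1 \<le> Kdelta \<delta>" "Kdelta \<delta> \<le> 9 / 2" by auto
qed

section \<open>Noise level against privacy parameter\<close>

lemma gaussian_mechanism_factor_ge:
  fixes K \<epsilon> \<eta> :: real
  assumes "1 \<le> K" "0 < \<epsilon>" "0 < \<eta>" "\<epsilon> \<le> 1 / \<eta>"
  shows "\<eta> \<le> (K + sqrt (K\<^sup>2 + 2 * \<epsilon>)) / (2 * \<epsilon>)"
proof -
  \<comment> \<open>The numerator is thus at least \<open>2 * K\<close>, hence at least 2.\<close>
  have "K \<le> sqrt (K\<^sup>2 + 2 * \<epsilon>)" using assms by (intro real_le_rsqrt) auto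
  moreover have "\<eta> * \<epsilon> \<le> 1" using assms by (simp add: field_simps)
  ultimately have "\<eta> * (2 * \<epsilon>) \<le> K + sqrt (K\<^sup>2 + 2 * \<epsilon>)" using assms by linarith
  then show ?thesis using assms by (simp add: pos_le_divide_eq)
qed

text \<open>With \<open>s = sqrt (2 * \<epsilon>)\<close> the last hypothesis says that
  \<open>s\<close> is at least the larger root of \<open>\<eta> * s\<^sup>2 - s - 9\<close>.
  Subadditivity of the root bounds the numerator by \<open>2 * K + s\<close>, hence by
  \<open>9 + s\<close>.\<close>

lemma gaussian_mechanism_factor_le:
  fixes K \<epsilon> \<eta> :: real
  assumes "0 \<le> K" "K \<le> 9 / 2" "0 < \<epsilon>" "0 < \<eta>"
    and "(1/8) * ((1 + sqrt (36 * \<eta> + 1)) / \<eta>)\<^sup>2 \<le> \<epsilon>"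
  shows "(K + sqrt (K\<^sup>2 + 2 * \<epsilon>)) / (2 * \<epsilon>) \<le> \<eta>"
proof -
  define s where "s = sqrt (2 * \<epsilon>)"
  define q where "q = sqrt (36 * \<eta> + 1)"
  have s: "0 < s" "s\<^sup>2 = 2 * \<epsilon>" using assms by (auto simp: s_def)
  have q: "0 \<le> q" "q\<^sup>2 = 36 * \<eta> + 1" using assms by (auto simp: q_def)
  have "((1 + q) / (2 * \<eta>))\<^sup>2 \<le> s\<^sup>2"
    using assms(5) s(2) by (simp add: q_def power_divide power_mult_distrib)
  then have "(1 + q) / (2 * \<eta>) \<le> s" by (rule power2_le_imp_le) (use s(1) in simp)
  then have "1 + q \<le> s * (2 * \<eta>)" using assms by (simp add: pos_divide_le_eq)
  then have "q \<le> 2 * \<eta> * s - 1" by (simp add: algebra_simps)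
  then have "q\<^sup>2 \<le> (2 * \<eta> * s - 1)\<^sup>2" using q(1) by (intro power_mono)
  then have "4 * \<eta> * 9 \<le> 4 * \<eta> * (\<eta> * s\<^sup>2 - s)"
    unfolding q(2) by (simp add: power2_eq_square algebra_simps)
  then have "9 + s \<le> \<eta> * (2 * \<epsilon>)" using assms s(2) by simp
  moreover have "sqrt (K\<^sup>2 + 2 * \<epsilon>) \<le> K + s"
    using sqrt_add_le_add_sqrt[of "K\<^sup>2" "2 * \<epsilon>"] assms by (simp add: s_def)
  ultimately have "K + sqrt (K\<^sup>2 + 2 * \<epsilon>) \<le> \<eta> * (2 * \<epsilon>)" using assms by linarith
  then show ?thesis using assms by (simp add: pos_divide_le_eq)
qed

section \<open>Positive definite matrices\<close>

lemma inner_matrix_vector_transpose: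
  fixes M :: "real^'n^'m"
  shows "(M *v x) \<bullet> y = x \<bullet> (transpose M *v y)"
  by (metis dot_lmul_matrix inner_commute transpose_matrix_vector)

lemma symmetric_matrix_inner:
  fixes M :: "real^'n^'n"
  assumes "transpose M = M"
  shows "(M *v x) \<bullet> y = x \<bullet> (M *v y)"
  using inner_matrix_vector_transpose[of M x y] assms by simp

lemma pd_matrix_imp_psd: "pd_matrix M \<Longrightarrow> psd_matrix M"
  unfolding pd_matrix_def psd_matrix_def by (metis inner_zero_left less_eq_real_def)

lemma pd_matrix_invertible:
  assumes "pd_matrix M"
  shows "invertible M"
proof -
  have "x = 0" if "M *v x = 0" for x
    using assms that unfolding pd_matrix_def by (metis inner_zero_right less_irrefl)
  then show ?thesis
    by (simp add: invertible_left_inverse matrix_left_invertible_ker)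
qed

text \<open>Moving from \<open>v\<close> a short way along \<open>- M *v v\<close> changes the form
  at first order by a negative multiple of the squared norm of \<open>M *v v\<close>, which
  nonnegativity forbids unless that vector vanishes.\<close>

lemma psd_matrix_zero_form_imp_kernel:
  fixes M :: "real^'n^'n"
  assumes "psd_matrix M" "v \<bullet> (M *v v) = 0"
  shows "M *v v = 0"
proof -
  define g where "g = M *v v"
  have sym: "transpose M = M" and nonneg: "\<And>x. 0 \<le> x \<bullet> (M *v x)"
    using assms(1) by (auto simp: psd_matrix_def)
  have quad: "0 \<le> t * (t * (g \<bullet> (M *v g)) - 2 * (g \<bullet> g))" for t
  proof -
    have "0 \<le> (v - t *\<^sub>R g) \<bullet> (M *v (v - t *\<^sub>R g))" by (rule nonneg)
    also have "\<dots> = t * (t * (g \<bullet> (M *v g)) - 2 * (g \<bullet> g))"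
      using symmetric_matrix_inner[OF sym, of v g] assms(2)
      by (simp add: matrix_vector_mult_diff_distrib matrix_vector_mult_scaleR inner_diff_left
          inner_diff_right g_def[symmetric] algebra_simps)
    finally show ?thesis .
  qed
  define a where "a = g \<bullet> (M *v g)"
  have a: "0 \<le> a" unfolding a_def by (rule nonneg)
  \<comment> \<open>The 1 in the denominator covers \<open>a = 0\<close> and still keeps
    \<open>t * a\<close> at most \<open>g \<bullet> g\<close>, below the required
    \<open>2 * (g \<bullet> g)\<close>.\<close>
  define t where "t = (g \<bullet> g) / (a + 1)"
  have "g \<bullet> g = 0"
  proof (rule ccontr)
    assume "g \<bullet> g \<noteq> 0"
    then have gg: "0 < g \<bullet> g" by simp
    then have "0 < t" using a by (simp add: t_def)
    with quad[of t] have "2 * (g \<bullet> g) \<le> t * a"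
      by (simp add: a_def zero_le_mult_iff)
    also have "t * a \<le> t * (a + 1)" using \<open>0 < t\<close> by simp
    also have "\<dots> = g \<bullet> g" using a by (simp add: t_def)
    finally show False using gg by simp
  qed
  then show ?thesis by (simp add: g_def)
qed

text \<open>\<open>Min\<close> in \<open>min_eigenvalue\<close> is meaningful only on a finite set.
  One eigenvector per eigenvalue yields an orthogonal, hence independent, hence finite
  family.\<close>

lemma finite_eigenvalues_symmetric:
  fixes M :: "real^'n^'n"
  assumes sym: "transpose M = M"
  shows "finite {c. \<exists>v. v \<noteq> 0 \<and> M *v v = c *\<^sub>R v}" (is "finite ?E")
proof -
  have "\<forall>c\<in>?E. \<exists>v. v \<noteq> 0 \<and> M *v v = c *\<^sub>R v" by blast
  then obtain f where f: "\<And>c. c \<in> ?E \<Longrightarrow> f c \<noteq> 0 \<and> M *v f c = c *\<^sub>R f c"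
    using bchoice[of ?E "\<lambda>c v. v \<noteq> 0 \<and> M *v v = c *\<^sub>R v"] by blast
  have orth: "f c \<bullet> f d = 0" if "c \<in> ?E" "d \<in> ?E" "c \<noteq> d" for c d
  proof -
    have "c * (f c \<bullet> f d) = d * (f c \<bullet> f d)"
      using symmetric_matrix_inner[OF sym, of "f c" "f d"] f[OF that(1)] f[OF that(2)] by simp
    then show ?thesis using that(3) by simp
  qed
  have inj: "inj_on f ?E"
  proof (rule inj_onI, rule ccontr)
    fix c d assume cd: "c \<in> ?E" "d \<in> ?E" "f c = f d" "c \<noteq> d"
    then have "f c \<bullet> f c = 0" using orth[of c d] by simp
    then show False using f[OF cd(1)] by simp
  qed
  have "pairwise orthogonal (f ` ?E)"
    unfolding pairwise_image by (rule pairwiseI) (simp add: orth orthogonal_def)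
  moreover have "0 \<notin> f ` ?E" using f by force
  ultimately have "independent (f ` ?E)" by (rule pairwise_orthogonal_independent)
  then have "finite (f ` ?E)" by (rule independent_imp_finite)
  then show ?thesis using inj by (rule finite_imageD)
qed

lemma diagonal_matrix_vector_nth:
  assumes "diagonal_matrix M"
  shows "(M *v x) $ j = M $ j $ j * x $ j"
proof -
  have "(M *v x) $ j = (\<Sum>k\<in>UNIV. if k = j then M $ j $ j * x $ j else 0)"
    unfolding matrix_vector_mult_def vec_lambda_beta using assms
    by (intro sum.cong) (auto simp: diagonal_matrix_def)
  then show ?thesis by simp
qed

text \<open>The form attains a minimum \<open>m\<close> on the compact unit sphere. Then
  \<open>M - mat m\<close> is positive semidefinite with zero form at the minimiser, so the
  minimiser is an eigenvector. It is returned as well, since it shows that the eigenvalue of a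
  positive definite matrix is positive.\<close>

lemma min_eigenvalue_rayleigh:
  fixes M :: "real^'n^'n"
  assumes sym: "transpose M = M"
  obtains v where "norm v = 1" "min_eigenvalue M = v \<bullet> (M *v v)"
    "\<And>x. min_eigenvalue M * (x \<bullet> x) \<le> x \<bullet> (M *v x)"
proof -
  have "continuous_on (sphere 0 1) (\<lambda>x. x \<bullet> (M *v x))"
    by (intro continuous_intros matrix_vector_mult_linear_continuous_on)
  moreover obtain e :: "real^'n" where "norm e = 1" using vector_choose_size[of 1] by auto
  then have "sphere (0 :: real^'n) 1 \<noteq> {}" by auto
  ultimately obtain v where "v \<in> sphere 0 1" "\<forall>y\<in>sphere 0 1. v \<bullet> (M *v v) \<le> y \<bullet> (M *v y)"
    using continuous_attains_inf[OF compact_sphere, of 0 1 "\<lambda>x. x \<bullet> (M *v x)"] by blast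
  then have v: "norm v = 1"
      and v_min: "\<And>y. norm y = 1 \<Longrightarrow> v \<bullet> (M *v v) \<le> y \<bullet> (M *v y)"
    by auto
  define m where "m = v \<bullet> (M *v v)"
  have vv: "v \<bullet> v = 1" using v by (simp add: norm_eq_1)
  have m_le: "m * (x \<bullet> x) \<le> x \<bullet> (M *v x)" for x
  proof (cases "x = 0")
    case False
    have "m \<le> (x /\<^sub>R norm x) \<bullet> (M *v (x /\<^sub>R norm x))"
      unfolding m_def using False by (intro v_min) simp
    also have "\<dots> = (x \<bullet> (M *v x)) / (x \<bullet> x)"
      by (simp add: matrix_vector_mult_scaleR dot_square_norm power2_eq_square divide_simps)
    finally show ?thesis using False by (simp add: pos_le_divide_eq)
  qed simp
  have shift: "(M - mat m) *v x = M *v x - m *\<^sub>R x" for x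
  proof -
    have "mat m *v x = m *\<^sub>R x"
      by (simp add: vec_eq_iff diagonal_matrix_vector_nth diagonal_matrix_def mat_def)
    then show ?thesis by (simp add: matrix_vector_mult_diff_rdistrib)
  qed
  have "psd_matrix (M - mat m)"
    unfolding psd_matrix_def shift using sym m_le
    by (auto simp: inner_diff_right transpose_def mat_def vec_eq_iff)
  moreover have "v \<bullet> ((M - mat m) *v v) = 0"
    by (simp add: shift inner_diff_right vv flip: m_def)
  ultimately have eig: "M *v v = m *\<^sub>R v"
    using psd_matrix_zero_form_imp_kernel shift by fastforce
  have "min_eigenvalue M = m"
    unfolding min_eigenvalue_def
  proof (rule Min_eqI)
    show "m \<in> {c. \<exists>v. v \<noteq> 0 \<and> M *v v = c *\<^sub>R v}"
      using eig v by (auto intro!: exI[of _ v])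
    show "m \<le> c" if c: "c \<in> {c. \<exists>v. v \<noteq> 0 \<and> M *v v = c *\<^sub>R v}" for c
    proof -
      obtain x where "x \<noteq> 0" "M *v x = c *\<^sub>R x" using c by blast
      then show ?thesis using m_le[of x] by simp
    qed
  qed (rule finite_eigenvalues_symmetric[OF sym])
  then show thesis using that v m_def m_le by blast
qed

lemma pd_matrix_diagonal_pos:
  assumes "pd_matrix M"
  shows "0 < M $ j $ j"
proof -
  have "0 < axis j 1 \<bullet> (M *v axis j 1)"
    using assms by (simp add: pd_matrix_def axis_eq_0_iff)
  then show ?thesis by (simp add: inner_axis' matrix_vector_mul_component inner_axis)
qed

text \<open>Since \<open>A $ i\<close> is the i-th row of \<open>A\<close>, bounds on the quadratic
  form of \<open>P\<close> suffice to bound the trace; the identity in place of \<open>P\<close>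
  gives the trace of \<open>transpose A ** A\<close>.\<close>

lemma trace_congruence:
  fixes A P :: "real^'n^'n"
  shows "trace (A ** P ** transpose A) = (\<Sum>i\<in>UNIV. A $ i \<bullet> (P *v A $ i))"
proof -
  have "(A ** P ** transpose A) $ i $ i = A $ i \<bullet> (P *v A $ i)" for i
  proof -
    have "(A ** P ** transpose A) $ i $ i = axis i 1 \<bullet> ((A ** P ** transpose A) *v axis i 1)"
      by (simp add: inner_axis' matrix_vector_mul_component inner_axis)
    also have "\<dots> = (transpose A *v axis i 1) \<bullet> (P *v (transpose A *v axis i 1))"
      by (simp add: inner_matrix_vector_transpose[of "transpose A"] flip: matrix_vector_mul_assoc
          del: transpose_matrix_vector)
    also have "transpose A *v axis i 1 = A $ i"
      by (simp add: matrix_vector_mult_basis column_transpose row_def vec_eq_iff del: transpose_matrix_vector)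
    finally show ?thesis .
  qed
  then show ?thesis by (simp add: trace_def)
qed

section \<open>The measurement update as a minimum\<close>

definition measurement_update :: "real^'n^'n \<Rightarrow> real^'n^'n \<Rightarrow> real^'n^'n \<Rightarrow> real^'n^'n" where
  "measurement_update C V S =
     S - S ** transpose C ** matrix_inv (C ** S ** transpose C + V) ** C ** S"

text \<open>For a filter gain \<open>L\<close> and \<open>w = L\<^sup>T x\<close> this is the variance of the estimation error in
  direction \<open>x\<close>.\<close>

definition gain_cost :: "real^'n^'n \<Rightarrow> real^'n^'n \<Rightarrow> real^'n^'n \<Rightarrow> real^'n \<Rightarrow> real^'n \<Rightarrow> real" where
  "gain_cost C V S x w =
     (x - transpose C *v w) \<bullet> (S *v (x - transpose C *v w)) + w \<bullet> (V *v w)"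

text \<open>Completing the square in \<open>w\<close>: the cost exceeds its minimum by the form of
  the innovation covariance \<open>G\<close> at \<open>w - w0\<close>, and \<open>G\<close> is
  positive definite because \<open>V\<close> is.\<close>

lemma measurement_update_min:
  fixes C V S :: "real^'n^'n"
  assumes S: "psd_matrix S" and V: "pd_matrix V"
  obtains w0 where "x \<bullet> (measurement_update C V S *v x) = gain_cost C V S x w0"
    "\<And>w. x \<bullet> (measurement_update C V S *v x) \<le> gain_cost C V S x w"
proof -
  define G where "G = C ** S ** transpose C + V"
  have symS: "transpose S = S" and symV: "transpose V = V"
    using S V by (auto simp: psd_matrix_def pd_matrix_def)
  have symG: "transpose G = G"
  proof -
    have "transpose (X + Y) = transpose X + transpose Y" for X Y :: "real^'n^'n"
      by (simp add: transpose_def vec_eq_iff)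
    then show ?thesis by (simp add: G_def matrix_transpose_mul matrix_mul_assoc symS symV)
  qed
  have G_form: "w \<bullet> (G *v y) = (transpose C *v w) \<bullet> (S *v (transpose C *v y)) + w \<bullet> (V *v y)" for w y
    by (simp add: G_def matrix_vector_mult_add_rdistrib inner_add_right
        inner_matrix_vector_transpose[of "transpose C"]
        flip: matrix_vector_mul_assoc del: transpose_matrix_vector)
  have pdG: "pd_matrix G"
    unfolding pd_matrix_def G_form using symG S V
    by (auto simp: psd_matrix_def pd_matrix_def add_nonneg_pos simp del: transpose_matrix_vector)
  \<comment> \<open>The transposed Kalman gain applied to \<open>x\<close>, where the gradient of
    the cost vanishes.\<close>
  define w0 where "w0 = matrix_inv G *v (C *v (S *v x))"
  have "G ** matrix_inv G = mat 1"
    using pd_matrix_invertible[OF pdG] unfolding invertible_def matrix_inv_def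
    by (rule someI2_ex) blast
  then have Gw0: "G *v w0 = C *v (S *v x)"
    by (metis w0_def matrix_vector_mul_assoc matrix_vector_mul_lid)
  have cross: "x \<bullet> (S *v (transpose C *v w)) = w \<bullet> (G *v w0)" for w
    using symmetric_matrix_inner[OF symS, of x "transpose C *v w"]
      inner_matrix_vector_transpose[of C "S *v x" w]
    by (simp add: Gw0 inner_commute del: transpose_matrix_vector)
  have "measurement_update C V S *v x = S *v x - S *v (transpose C *v w0)"
    by (simp add: measurement_update_def w0_def matrix_vector_mult_diff_rdistrib
        flip: G_def matrix_vector_mul_assoc del: transpose_matrix_vector)
  then have P: "x \<bullet> (measurement_update C V S *v x) = x \<bullet> (S *v x) - w0 \<bullet> (G *v w0)"
    by (simp add: inner_diff_right cross del: transpose_matrix_vector)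
  have cost: "gain_cost C V S x w
      = x \<bullet> (measurement_update C V S *v x) + (w - w0) \<bullet> (G *v (w - w0))" for w
  proof -
    define c where "c = transpose C *v w"
    have c: "x \<bullet> (S *v c) = w \<bullet> (G *v w0)"
      unfolding c_def by (rule cross)
    moreover have "c \<bullet> (S *v x) = x \<bullet> (S *v c)"
      using symmetric_matrix_inner[OF symS, of c x] by (simp add: inner_commute)
    moreover have "w0 \<bullet> (G *v w) = w \<bullet> (G *v w0)"
      using symmetric_matrix_inner[OF symG, of w0 w] by (simp add: inner_commute)
    ultimately show ?thesis
      using G_form[of w w]
      by (simp add: P gain_cost_def matrix_vector_mult_diff_distrib inner_diff_left inner_diff_right
          flip: c_def del: transpose_matrix_vector)
  qed
  have "0 \<le> (w - w0) \<bullet> (G *v (w - w0))" for w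
    using pd_matrix_imp_psd[OF pdG] by (simp add: psd_matrix_def)
  then show thesis
    using that[of w0] cost by simp
qed

text \<open>The gain \<open>C\<inverse>\<close> removes the dependence on the prior covariance.\<close>

lemma measurement_update_upper:
  fixes C V S :: "real^'n^'n"
  assumes S: "psd_matrix S" and V: "pd_matrix V"
    and Cd: "diagonal_matrix C" and Vd: "diagonal_matrix V"
    and d: "0 < d" and snr: "\<And>j. d \<le> (C $ j $ j)\<^sup>2 / V $ j $ j"
  shows "x \<bullet> (measurement_update C V S *v x) \<le> (x \<bullet> x) / d"
proof -
  have Vpos: "0 < V $ j $ j" for j by (rule pd_matrix_diagonal_pos[OF V])
  have Cnz: "C $ j $ j \<noteq> 0" for j using snr[of j] d by auto
  have trC: "transpose C = C"
    using Cd by (simp add: diagonal_matrix_def transpose_def vec_eq_iff) metis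
  define w :: "real^'n" where "w = (\<chi> j. x $ j / C $ j $ j)"
  have "C *v w = x"
    by (simp add: vec_eq_iff diagonal_matrix_vector_nth[OF Cd] w_def Cnz)
  then have "gain_cost C V S x w = w \<bullet> (V *v w)"
    by (simp add: gain_cost_def trC del: transpose_matrix_vector)
  also have "\<dots> = (\<Sum>j\<in>UNIV. V $ j $ j / (C $ j $ j)\<^sup>2 * (x $ j)\<^sup>2)"
    by (simp add: inner_vec_def diagonal_matrix_vector_nth[OF Vd] w_def power2_eq_square field_simps)
  also have "\<dots> \<le> (\<Sum>j\<in>UNIV. 1 / d * (x $ j)\<^sup>2)"
  proof (intro sum_mono mult_right_mono)
    show "V $ j $ j / (C $ j $ j)\<^sup>2 \<le> 1 / d" for j
      using snr[of j] d Vpos[of j] Cnz[of j] by (simp add: field_simps)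
  qed simp
  also have "\<dots> = (x \<bullet> x) / d"
    by (simp add: inner_vec_def power2_eq_square sum_divide_distrib)
  finally show ?thesis
    using measurement_update_min[OF S V, of x C] by (metis order_trans)
qed

text \<open>After clearing denominators the gap is the squared norm of
  \<open>d *\<^sub>R a - p *\<^sub>R b\<close>.\<close>

lemma parallel_sum_le:
  fixes a b :: "'a::real_inner"
  assumes "0 < p" "0 < d"
  shows "((a + b) \<bullet> (a + b)) / (p + d) \<le> (a \<bullet> a) / p + (b \<bullet> b) / d"
proof -
  have "0 \<le> (d *\<^sub>R a - p *\<^sub>R b) \<bullet> (d *\<^sub>R a - p *\<^sub>R b)" by simp
  then have "p * d * ((a + b) \<bullet> (a + b)) \<le> (p + d) * (d * (a \<bullet> a) + p * (b \<bullet> b))"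
    by (simp add: inner_add_left inner_add_right inner_diff_left inner_diff_right inner_commute[of b a]
        algebra_simps)
  moreover have "(a \<bullet> a) / p + (b \<bullet> b) / d = (d * (a \<bullet> a) + p * (b \<bullet> b)) / (p * d)"
    using assms by (simp add: add_frac_eq mult.commute)
  ultimately show ?thesis
    using assms by (simp add: frac_le_eq divide_le_eq pos_le_divide_eq mult.commute mult.left_commute)
qed

text \<open>At the optimal \<open>w\<close>, split \<open>x\<close> into \<open>x - C *v w\<close>
  and \<open>C *v w\<close>. The prior term costs at least \<open>m\<close> times the squared norm
  of the first part, the noise term at least the squared norm of the second divided by
  \<open>d\<close>; \<open>parallel_sum_le\<close> combines them.\<close>

lemma measurement_update_lower:
  fixes C V S :: "real^'n^'n"
  assumes S: "psd_matrix S" and V: "pd_matrix V"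
    and Cd: "diagonal_matrix C" and Vd: "diagonal_matrix V"
    and m: "0 < m" and Sm: "\<And>x. m * (x \<bullet> x) \<le> x \<bullet> (S *v x)"
    and d: "0 < d" and snr: "\<And>j. (C $ j $ j)\<^sup>2 / V $ j $ j \<le> d"
  shows "(x \<bullet> x) / (1 / m + d) \<le> x \<bullet> (measurement_update C V S *v x)"
proof -
  have Vpos: "0 < V $ j $ j" for j by (rule pd_matrix_diagonal_pos[OF V])
  have trC: "transpose C = C"
    using Cd by (simp add: diagonal_matrix_def transpose_def vec_eq_iff) metis
  obtain w where w: "x \<bullet> (measurement_update C V S *v x) = gain_cost C V S x w"
    using measurement_update_min[OF S V] by metis
  define c where "c = C *v w"
  have "(c \<bullet> c) / d = (\<Sum>j\<in>UNIV. (C $ j $ j)\<^sup>2 / d * (w $ j)\<^sup>2)"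
    by (simp add: c_def inner_vec_def diagonal_matrix_vector_nth[OF Cd] sum_divide_distrib
        power2_eq_square field_simps)
  also have "\<dots> \<le> (\<Sum>j\<in>UNIV. V $ j $ j * (w $ j)\<^sup>2)"
  proof (intro sum_mono mult_right_mono)
    show "(C $ j $ j)\<^sup>2 / d \<le> V $ j $ j" for j
      using snr[of j] d Vpos[of j] by (simp add: field_simps)
  qed simp
  also have "\<dots> = w \<bullet> (V *v w)"
    by (simp add: inner_vec_def diagonal_matrix_vector_nth[OF Vd] power2_eq_square field_simps)
  finally have c_le: "(c \<bullet> c) / d \<le> w \<bullet> (V *v w)" .
  have "(x \<bullet> x) / (1 / m + d) \<le> ((x - c) \<bullet> (x - c)) / (1 / m) + (c \<bullet> c) / d"
    using parallel_sum_le[of "1 / m" d "x - c" c] m d by simp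
  also have "\<dots> \<le> (x - c) \<bullet> (S *v (x - c)) + w \<bullet> (V *v w)"
    using Sm[of "x - c"] c_le by (simp add: mult.commute)
  also have "\<dots> = x \<bullet> (measurement_update C V S *v x)"
    unfolding w by (simp add: gain_cost_def trC c_def del: transpose_matrix_vector)
  finally show ?thesis .
qed

section \<open>The Riccati equation and the trace bounds\<close>

lemma riccati_eq_measurement_update:
  fixes A C V S W :: "real^'n^'n"
  shows "A ** S ** transpose A
      - A ** S ** transpose C ** matrix_inv (C ** S ** transpose C + V) ** C ** S ** transpose A + W
    = A ** measurement_update C V S ** transpose A + W"
proof -
  have "A ** (X - Y) ** transpose A = A ** X ** transpose A - A ** Y ** transpose A"
    for X Y :: "real^'n^'n"
    by (simp add: matrix_eq matrix_vector_mult_diff_rdistrib matrix_vector_mult_diff_distrib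
        flip: matrix_vector_mul_assoc del: transpose_matrix_vector)
  then show ?thesis by (simp add: measurement_update_def matrix_mul_assoc)
qed

theorem theorem7:
  fixes A W C \<Sigma> :: "real^'n^'n"
    and owner :: "'n \<Rightarrow> 'm::finite"
    and b \<Delta> \<delta> \<epsilon> \<sigma> :: "'m \<Rightarrow> real"
    and V :: "real^'n^'n"
    and B_l B_u :: real
    and l u :: 'n
    and \<eta>1 \<eta>2 :: "'m \<Rightarrow> real"
  assumes W_pd: "pd_matrix W"
    and C_diag: "diagonal_matrix C" and C_pd: "pd_matrix C"
    and b_pos: "\<forall>i. b i > 0"
    and \<Delta>_def: "\<forall>i. \<Delta> i = output_sensitivity C (owner -` {i}) (b i)"
    and \<Delta>_pos: "\<forall>i. \<Delta> i > 0"
    and \<delta>_range: "\<forall>i. 10 powr (-5) \<le> \<delta> i \<and> \<delta> i \<le> 10 powr (-1)"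
    and \<epsilon>_pos: "\<forall>i. \<epsilon> i > 0"
    and \<sigma>_def: "\<forall>i. \<sigma> i = \<Delta> i / (2 * \<epsilon> i) *
                        (Kdelta (\<delta> i) + sqrt ((Kdelta (\<delta> i))\<^sup>2 + 2 * \<epsilon> i))"
    and V_def: "V = (\<chi> j k. if j = k then (\<sigma> (owner j))\<^sup>2 else 0)"
    and \<Sigma>_psd: "psd_matrix \<Sigma>"
    and \<Sigma>_dare: "\<Sigma> = A ** \<Sigma> ** transpose A
        - A ** \<Sigma> ** transpose C ** matrix_inv (C ** \<Sigma> ** transpose C + V) ** C ** \<Sigma> ** transpose A
        + W"
    and \<Sigma>_unique: "\<forall>S. psd_matrix S \<and>
        S = A ** S ** transpose A
          - A ** S ** transpose C ** matrix_inv (C ** S ** transpose C + V) ** C ** S ** transpose A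
          + W \<longrightarrow> S = \<Sigma>"
    and l_min: "\<forall>j. (C $ l $ l)\<^sup>2 / (\<sigma> (owner l))\<^sup>2 \<le> (C $ j $ j)\<^sup>2 / (\<sigma> (owner j))\<^sup>2"
    and u_max: "\<forall>j. (C $ j $ j)\<^sup>2 / (\<sigma> (owner j))\<^sup>2 \<le> (C $ u $ u)\<^sup>2 / (\<sigma> (owner u))\<^sup>2"
    and \<eta>1_def: "\<forall>i. \<eta>1 i = sqrt ((B_l - trace W) * min_eigenvalue W * (C $ u $ u)\<^sup>2 /
          ((\<Delta> i)\<^sup>2 * (trace (transpose A ** A) * min_eigenvalue W - B_l + trace W)))"
    and \<eta>2_def: "\<forall>i. \<eta>2 i = sqrt ((B_u - trace W) * (C $ l $ l)\<^sup>2 /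
          ((\<Delta> i)\<^sup>2 * trace (transpose A ** A)))"
    and \<eta>_pos: "\<forall>i. \<eta>1 i > 0 \<and> \<eta>2 i > 0"
    and \<epsilon>_bounds: "\<forall>i. (1/8) * ((1 + sqrt (36 * \<eta>2 i + 1)) / \<eta>2 i)\<^sup>2 \<le> \<epsilon> i
                        \<and> \<epsilon> i \<le> 1 / \<eta>1 i"
  shows "B_l \<le> trace \<Sigma> \<and> trace \<Sigma> \<le> B_u"
proof -
  have K: "1 \<le> Kdelta (\<delta> i)" "Kdelta (\<delta> i) \<le> 9 / 2" for i
    using Kdelta_bounds[of "\<delta> i"] \<delta>_range by auto
  \<comment> \<open>The sensitivity enters \<open>\<sigma> i\<close> as a factor and
    \<open>\<eta>1 i\<close>, \<open>\<eta>2 i\<close> as a divisor, so the products with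
    \<open>\<Delta> i\<close> depend only on the matrices and the targets.\<close>
  have \<sigma>_ge: "\<eta>1 i * \<Delta> i \<le> \<sigma> i" and \<sigma>_le: "\<sigma> i \<le> \<eta>2 i * \<Delta> i" for i
  proof -
    define r where "r = (Kdelta (\<delta> i) + sqrt ((Kdelta (\<delta> i))\<^sup>2 + 2 * \<epsilon> i)) / (2 * \<epsilon> i)"
    have \<sigma>: "\<sigma> i = r * \<Delta> i" using \<sigma>_def by (simp add: r_def)
    have "\<eta>1 i \<le> r"
      unfolding r_def using K \<epsilon>_pos \<eta>_pos \<epsilon>_bounds by (intro gaussian_mechanism_factor_ge) auto
    moreover have "r \<le> \<eta>2 i"
      unfolding r_def using K[of i] \<epsilon>_pos \<eta>_pos \<epsilon>_bounds
      by (intro gaussian_mechanism_factor_le) auto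
    moreover have "0 \<le> \<Delta> i" using \<Delta>_pos less_imp_le by blast
    ultimately show "\<eta>1 i * \<Delta> i \<le> \<sigma> i" "\<sigma> i \<le> \<eta>2 i * \<Delta> i"
      unfolding \<sigma> by (auto intro: mult_right_mono)
  qed
  have \<eta>1\<Delta>: "0 < \<eta>1 i * \<Delta> i" for i using \<eta>_pos \<Delta>_pos by simp
  have \<sigma>_pos: "0 < \<sigma> i" for i using \<sigma>_ge[of i] \<eta>1\<Delta>[of i] by linarith
  have Cpos: "0 < C $ j $ j" for j by (rule pd_matrix_diagonal_pos[OF C_pd])
  have Vd: "diagonal_matrix V" by (simp add: diagonal_matrix_def V_def)
  have Vjj: "V $ j $ j = (\<sigma> (owner j))\<^sup>2" for j by (simp add: V_def)
  have V_pd: "pd_matrix V"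
    unfolding pd_matrix_def
  proof (intro conjI allI impI)
    show "transpose V = V" by (auto simp: V_def transpose_def vec_eq_iff)
    fix x :: "real^'n" assume "x \<noteq> 0"
    then obtain k where "x $ k \<noteq> 0" by (auto simp: vec_eq_iff)
    then have "0 < (\<sigma> (owner k))\<^sup>2 * (x $ k)\<^sup>2" using \<sigma>_pos[of "owner k"] by simp
    then have "0 < (\<Sum>j\<in>UNIV. (\<sigma> (owner j))\<^sup>2 * (x $ j)\<^sup>2)"
      by (intro sum_pos2[of _ k]) auto
    then show "0 < x \<bullet> (V *v x)"
      by (simp add: inner_vec_def diagonal_matrix_vector_nth[OF Vd] Vjj power2_eq_square algebra_simps)
  qed
  define P where "P = measurement_update C V \<Sigma>"
  define T where "T = trace (transpose A ** A)"
  define m where "m = min_eigenvalue W"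
  have \<Sigma>: "\<Sigma> = A ** P ** transpose A + W"
    using \<Sigma>_dare unfolding riccati_eq_measurement_update P_def .
  have T_rows: "T = (\<Sum>i\<in>UNIV. A $ i \<bullet> A $ i)"
    using trace_congruence[of A "mat 1"] trace_mul_sym[of "transpose A" A] by (simp add: T_def)
  then have T_nonneg: "0 \<le> T" by (simp add: sum_nonneg)
  have tr_\<Sigma>: "trace \<Sigma> = (\<Sum>i\<in>UNIV. A $ i \<bullet> (P *v A $ i)) + trace W"
    by (subst \<Sigma>) (simp add: trace_add trace_congruence)
  have W_sym: "transpose W = W" using W_pd by (simp add: pd_matrix_def)
  obtain v where v: "norm v = 1" "m = v \<bullet> (W *v v)"
    and W_ge: "\<And>x. m * (x \<bullet> x) \<le> x \<bullet> (W *v x)"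
    using min_eigenvalue_rayleigh[OF W_sym] unfolding m_def by metis
  have m_pos: "0 < m"
    using W_pd v unfolding pd_matrix_def by (metis norm_zero zero_neq_one)
  have P_nonneg: "0 \<le> x \<bullet> (P *v x)" for x
  proof -
    obtain w where "x \<bullet> (P *v x) = gain_cost C V \<Sigma> x w"
      using measurement_update_min[OF \<Sigma>_psd V_pd] unfolding P_def by metis
    then show ?thesis
      using \<Sigma>_psd pd_matrix_imp_psd[OF V_pd]
      by (simp add: gain_cost_def psd_matrix_def del: transpose_matrix_vector)
  qed
  \<comment> \<open>\<open>\<Sigma>\<close> dominates \<open>W\<close> because
    \<open>A ** P ** transpose A\<close> has a nonnegative form.\<close>
  have \<Sigma>_ge: "m * (x \<bullet> x) \<le> x \<bullet> (\<Sigma> *v x)" for x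
  proof -
    have "x \<bullet> (\<Sigma> *v x) = (transpose A *v x) \<bullet> (P *v (transpose A *v x)) + x \<bullet> (W *v x)"
      by (subst \<Sigma>) (simp add: matrix_vector_mult_add_rdistrib inner_add_right
          inner_matrix_vector_transpose[of "transpose A"]
          flip: matrix_vector_mul_assoc del: transpose_matrix_vector)
    then show ?thesis using W_ge[of x] P_nonneg[of "transpose A *v x"] by linarith
  qed
  have upper: "trace \<Sigma> \<le> B_u"
  proof -
    define i where "i = owner l"
    define d where "d = (C $ l $ l)\<^sup>2 / (\<sigma> i)\<^sup>2"
    have d: "0 < d" using Cpos[of l] \<sigma>_pos[of i] by (simp add: d_def)
    have "x \<bullet> (P *v x) \<le> (x \<bullet> x) / d" for x
      unfolding P_def using l_min
      by (intro measurement_update_upper \<Sigma>_psd V_pd C_diag Vd d) (simp add: d_def i_def Vjj)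
    then have "trace \<Sigma> \<le> T / d + trace W"
      unfolding tr_\<Sigma> T_rows sum_divide_distrib by (simp add: sum_mono)
    also have "T / d \<le> B_u - trace W"
    proof -
      \<comment> \<open>A positive root forces a positive radicand. This excludes
        \<open>T = 0\<close>, where division by zero would give 0, and lets the square undo the
        root.\<close>
      have rad: "0 < (B_u - trace W) * (C $ l $ l)\<^sup>2 / ((\<Delta> i)\<^sup>2 * T)"
        using \<eta>_pos \<eta>2_def by (metis T_def real_sqrt_gt_0_iff)
      then have "T \<noteq> 0" by auto
      then have T_pos: "0 < T" using T_nonneg by simp
      have "(\<sigma> i)\<^sup>2 \<le> (\<eta>2 i * \<Delta> i)\<^sup>2" using \<sigma>_le \<sigma>_pos[of i] by (intro power_mono) auto
      also have "\<dots> = (B_u - trace W) * (C $ l $ l)\<^sup>2 / ((\<Delta> i)\<^sup>2 * T) * (\<Delta> i)\<^sup>2"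
        using rad \<eta>2_def by (simp add: power_mult_distrib T_def)
      also have "\<dots> = (B_u - trace W) * (C $ l $ l)\<^sup>2 / T"
        using \<Delta>_pos by (simp add: less_imp_neq[THEN not_sym])
      finally have "T * (\<sigma> i)\<^sup>2 \<le> (B_u - trace W) * (C $ l $ l)\<^sup>2"
        using T_pos by (simp add: pos_le_divide_eq mult.commute)
      then show ?thesis using Cpos[of l] by (simp add: d_def divide_le_eq)
    qed
    finally show ?thesis by simp
  qed
  have lower: "B_l \<le> trace \<Sigma>"
  proof -
    define i where "i = owner u"
    define d where "d = (C $ u $ u)\<^sup>2 / (\<sigma> i)\<^sup>2"
    have d: "0 < d" using Cpos[of u] \<sigma>_pos[of i] by (simp add: d_def)
    define D where "D = T * m - B_l + trace W"
    have "(x \<bullet> x) / (1 / m + d) \<le> x \<bullet> (P *v x)" for x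
      unfolding P_def using u_max
      by (intro measurement_update_lower \<Sigma>_psd V_pd C_diag Vd d m_pos \<Sigma>_ge) (simp add: d_def i_def Vjj)
    then have "T / (1 / m + d) + trace W \<le> trace \<Sigma>"
      unfolding tr_\<Sigma> T_rows sum_divide_distrib by (simp add: sum_mono)
    moreover have "B_l - trace W \<le> T / (1 / m + d)"
    proof -
      have rad: "0 < (B_l - trace W) * m * (C $ u $ u)\<^sup>2 / ((\<Delta> i)\<^sup>2 * D)"
        using \<eta>_pos \<eta>1_def by (metis T_def m_def D_def real_sqrt_gt_0_iff)
      \<comment> \<open>Only the sign of the whole quotient is known. For \<open>D < 0\<close> the
        difference \<open>B_l - trace W\<close> would exceed \<open>T * m\<close>, making the
        numerator nonnegative and the quotient nonpositive; \<open>D = 0\<close> would make the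
        quotient 0.\<close>
      have D_pos: "0 < D"
      proof (rule ccontr)
        assume "\<not> 0 < D"
        moreover have "D \<noteq> 0" using rad by auto
        ultimately have "D < 0" by simp
        then have "0 < B_l - trace W"
          using mult_nonneg_nonneg[OF T_nonneg less_imp_le[OF m_pos]] by (simp add: D_def)
        then have "0 \<le> (B_l - trace W) * m * (C $ u $ u)\<^sup>2" using m_pos by simp
        moreover have "(\<Delta> i)\<^sup>2 * D \<le> 0" using \<open>D < 0\<close> by (simp add: mult_nonneg_nonpos)
        ultimately have "(B_l - trace W) * m * (C $ u $ u)\<^sup>2 / ((\<Delta> i)\<^sup>2 * D) \<le> 0"
          by (rule divide_nonneg_nonpos)
        with rad show False by simp
      qed
      have "(B_l - trace W) * m * (C $ u $ u)\<^sup>2 / D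
          = (B_l - trace W) * m * (C $ u $ u)\<^sup>2 / ((\<Delta> i)\<^sup>2 * D) * (\<Delta> i)\<^sup>2"
        using \<Delta>_pos by (simp add: less_imp_neq[THEN not_sym])
      also have "\<dots> = (\<eta>1 i * \<Delta> i)\<^sup>2"
        using rad \<eta>1_def by (simp add: power_mult_distrib T_def m_def D_def)
      also have "\<dots> \<le> (\<sigma> i)\<^sup>2" using \<sigma>_ge \<eta>1\<Delta>[of i] by (intro power_mono) auto
      \<comment> \<open>\<open>D\<close> itself contains \<open>- (B_l - trace W)\<close>; moving
        that term to the left produces the denominator of \<open>T / (1 / m + d)\<close>.\<close>
      finally have "(B_l - trace W) * (m * (C $ u $ u)\<^sup>2 + (\<sigma> i)\<^sup>2) \<le> T * m * (\<sigma> i)\<^sup>2"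
        using D_pos by (simp add: pos_divide_le_eq D_def algebra_simps)
      moreover have "T / (1 / m + d) = T * m * (\<sigma> i)\<^sup>2 / (m * (C $ u $ u)\<^sup>2 + (\<sigma> i)\<^sup>2)"
        using m_pos \<sigma>_pos[of i] by (simp add: d_def field_simps)
      moreover have "0 < m * (C $ u $ u)\<^sup>2 + (\<sigma> i)\<^sup>2"
        using m_pos \<sigma>_pos[of i] by (simp add: add_nonneg_pos)
      ultimately show ?thesis by (simp add: pos_le_divide_eq)
    qed
    ultimately show ?thesis by simp
  qed
  show ?thesis using lower upper ..
qed

end
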